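(* Let $\Sigma$ be a finite nonempty set, let $\mu\in\mathbb{P}(\Sigma)$ be a fixed probability vector, let $\ell=(\ell_i)_{i\in\Sigma}$ be a vector of non-negative reals, and let $D\in[0,\infty)$ satisfy $D<\sum_{i\in\Sigma}\ell_i\mu_i$. Let $$R^-(D)=\inf\Big\{\sum_{i\in\Sigma}|\nu_i-\mu_i|:\ \nu\in\mathbb{P}(\Sigma),\ \sum_{i\in\Sigma}\ell_i\nu_i\le D\Big\}.$$ (1) If for some $k\in\{1,\dots,r\}$ $$\ell_{\min}\Big(\sum_{j=0}^{k}\mu(\Sigma^j)+\mu(\Sigma_0)\Big)+\sum_{j=k+1}^{r}\sum_{i\in\Sigma^j}\ell_i\mu_i\ \le\ D\ \le\ \ell_{\min}\Big(\sum_{j=1}^{k}\mu(\Sigma^{j-1})+\mu(\Sigma_0)\Big)+\sum_{j=k}^{r}\sum_{i\in\Sigma^j}\ell_i\mu_i,$$ then $$R^-(D)=\frac{2\Big(D-\ell_{\min}\,\mu(\Sigma_0)-\ell(\Sigma^k)\sum_{j=1}^{k}\mu(\Sigma^{j-1})-\sum_{j=k}^{r}\sum_{i\in\Sigma^j}\ell_i\mu_i\Big)}{\ell_{\min}-\ell(\Sigma^k)}.$$ (2) If $D\ge(\ell_{\min}-\ell_{\max})\,\mu(\Sigma^0)+\sum_{i\in\Sigma}\ell_i\mu_i$, then $$R^-(D)=\frac{2\big(D-\sum_{i\in\Sigma}\ell_i\mu_i\big)}{\ell_{\min}-\ell_{\max}}.$$ Moreover, in these cases the infimum is attained, $R^-(D)=\sum_{i\in\Sigma}|\nu^*_i-\mu_i|$,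 where the masses of the optimal (minimizing) probability vector $\nu^*$ are given by $$\nu^*(\Sigma_0)=\mu(\Sigma_0)+\alpha,$$ $$\nu^*(\Sigma^0)=\big(\mu(\Sigma^0)-\alpha\big)^+,$$ $$\nu^*(\Sigma^k)=\Big(\mu(\Sigma^k)-\Big(\alpha-\sum_{j=1}^{k}\mu(\Sigma^{j-1})\Big)^+\Big)^+,\qquad k=1,\dots,r,$$ $$\alpha=\min\Big(\frac{R^-(D)}{2},\,1-\mu(\Sigma_0)\Big).$$
   Context: $\mathbb{P}(\Sigma)$ is the set of probability vectors $p=(p_i)_{i\in\Sigma}$, $p_i\ge 0$, $\sum_{i}p_i=1$. For $p\in\mathbb{P}(\Sigma)$ and $A\subseteq\Sigma$, $p(A)=\sum_{i\in A}p_i$. For a real $x$, $x^+=\max(x,0)$. Set $\ell_{\max}=\max_{i\in\Sigma}\ell_i$, $\ell_{\min}=\min_{i\in\Sigma}\ell_i$, $\Sigma^0=\{i\in\Sigma:\ell_i=\ell_{\max}\}$, $\Sigma_0=\{i\in\Sigma:\ell_i=\ell_{\min}\}$. Recursively, for $k=1,2,\dots$, as long as $\Sigma\setminus(\Sigma_0\cup\Sigma^0\cup\dots\cup\Sigma^{k-1})$ is nonempty, let $\ell(\Sigma^k)=\max\{\ell_i: i\in\Sigma\setminus(\Sigma_0\cup\Sigma^0\cup\dots\cup\Sigma^{k-1})\}$ and $\Sigma^k=\{i\in\Sigma:\ell_i=\ell(\Sigma^k)\}$. Let $r$ be the number of sets $\Sigma^k$ ($k\ge 1$) so obtained, i.e.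 the number of distinct values of $\ell$ strictly between $\ell_{\min}$ and $\ell_{\max}$ (possibly $0$); empty sums are $0$. *)

theory Defs
  imports Complex_Main
begin

text \<open>
  Vectors indexed by a finite set \<open>S\<close> are functions of which only the values on \<open>S\<close> matter.
  The mass \<open>p(A)\<close> of \<open>A \<subseteq> S\<close> is \<open>sum p A\<close>.
\<close>

definition prob_vectors :: "'a set \<Rightarrow> ('a \<Rightarrow> real) set" where
  "prob_vectors S = {p. (\<forall>i\<in>S. 0 \<le> p i) \<and> (\<Sum>i\<in>S. p i) = 1}"

definition l_max :: "'a set \<Rightarrow> ('a \<Rightarrow> real) \<Rightarrow> real" where
  "l_max S l = Max (l ` S)"

definition l_min :: "'a set \<Rightarrow> ('a \<Rightarrow> real) \<Rightarrow> real" where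
  "l_min S l = Min (l ` S)"

text \<open>\<open>bottom S l\<close> is \<open>\<Sigma>\<^sub>0\<close>, and \<open>level S l k\<close> is \<open>\<Sigma>\<^sup>k\<close>.\<close>

definition bottom :: "'a set \<Rightarrow> ('a \<Rightarrow> real) \<Rightarrow> 'a set" where
  "bottom S l = {i \<in> S. l i = l_min S l}"

text \<open>The recursion stops once nothing remains; from then on \<open>level S l k\<close> is empty.\<close>

fun level :: "'a set \<Rightarrow> ('a \<Rightarrow> real) \<Rightarrow> nat \<Rightarrow> 'a set" where
  "level S l 0 = {i \<in> S. l i = l_max S l}"
| "level S l (Suc k) =
     (let T = S - (bottom S l \<union> (\<Union>j\<in>{..k}. level S l j))
      in if T = {} then {} else {i \<in> S. l i = Max (l ` T)})"

definition remaining :: "'a set \<Rightarrow> ('a \<Rightarrow> real) \<Rightarrow> nat \<Rightarrow> 'a set" where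
  "remaining S l k = S - (bottom S l \<union> (\<Union>j\<in>{..<k}. level S l j))"

text \<open>\<open>level_value S l k\<close> is \<open>l(\<Sigma>\<^sup>k)\<close>; it is meaningful only for \<open>1 \<le> k \<le> num_levels S l\<close>.\<close>

definition level_value :: "'a set \<Rightarrow> ('a \<Rightarrow> real) \<Rightarrow> nat \<Rightarrow> real" where
  "level_value S l k = Max (l ` remaining S l k)"

definition num_levels :: "'a set \<Rightarrow> ('a \<Rightarrow> real) \<Rightarrow> nat" where
  "num_levels S l = card {k. 1 \<le> k \<and> remaining S l k \<noteq> {}}"

definition l1_dist :: "'a set \<Rightarrow> ('a \<Rightarrow> real) \<Rightarrow> ('a \<Rightarrow> real) \<Rightarrow> real" where
  "l1_dist S \<nu> \<mu> = (\<Sum>i\<in>S. \<bar>\<nu> i - \<mu> i\<bar>)"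

definition feasible :: "'a set \<Rightarrow> ('a \<Rightarrow> real) \<Rightarrow> real \<Rightarrow> ('a \<Rightarrow> real) set" where
  "feasible S l D = {\<nu> \<in> prob_vectors S. (\<Sum>i\<in>S. l i * \<nu> i) \<le> D}"

text \<open>
  The real-valued infimum is the intended one exactly when the feasible set is nonempty,
  that is, when \<open>l_min S l \<le> D\<close>.
\<close>

definition R_minus :: "'a set \<Rightarrow> ('a \<Rightarrow> real) \<Rightarrow> ('a \<Rightarrow> real) \<Rightarrow> real \<Rightarrow> real" where
  "R_minus S \<mu> l D = (INF \<nu>\<in>feasible S l D. l1_dist S \<nu> \<mu>)"

definition minimizers :: "'a set \<Rightarrow> ('a \<Rightarrow> real) \<Rightarrow> ('a \<Rightarrow> real) \<Rightarrow> real \<Rightarrow> ('a \<Rightarrow> real) set" where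
  "minimizers S \<mu> l D = {\<nu> \<in> feasible S l D. R_minus S \<mu> l D = l1_dist S \<nu> \<mu>}"

definition pos_part :: "real \<Rightarrow> real" where
  "pos_part x = max x 0"

definition alpha :: "'a set \<Rightarrow> ('a \<Rightarrow> real) \<Rightarrow> ('a \<Rightarrow> real) \<Rightarrow> real \<Rightarrow> real" where
  "alpha S \<mu> l D = min (R_minus S \<mu> l D / 2) (1 - sum \<mu> (bottom S l))"

definition has_optimal_masses ::
    "'a set \<Rightarrow> ('a \<Rightarrow> real) \<Rightarrow> ('a \<Rightarrow> real) \<Rightarrow> real \<Rightarrow> ('a \<Rightarrow> real) \<Rightarrow> bool" where
  "has_optimal_masses S \<mu> l D \<nu> \<longleftrightarrow>
     sum \<nu> (bottom S l) = sum \<mu> (bottom S l) + alpha S \<mu> l D \<and>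
     sum \<nu> (level S l 0) = pos_part (sum \<mu> (level S l 0) - alpha S \<mu> l D) \<and>
     (\<forall>k\<in>{1..num_levels S l}.
        sum \<nu> (level S l k) =
          pos_part (sum \<mu> (level S l k)
            - pos_part (alpha S \<mu> l D - (\<Sum>j=1..k. sum \<mu> (level S l (j - 1))))))"

end

theory Submission
  imports Defs
begin

text \<open>
  Half of the l1 distance is the mass \<open>d\<close> that is moved. Lowering the mean cost as much as
  possible with a given \<open>d\<close> is a fractional knapsack problem: mass is taken from the
  highest levels of \<open>l\<close> first and put into the bottom level. With \<open>c\<close> the level at which
  the greedy removal stops and \<open>m\<close> the least value of \<open>l\<close>, weak duality bounds the gain by
  \<open>(\<Sum>i | l i > c. (l i - c) * \<mu> i) + (c - m) * d\<close>, and the equality case of this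
  bound determines the masses of the levels.
\<close>

section \<open>Weak duality for a threshold \<open>c\<close>, its equality case, and a greedy
  optimal vector\<close>

text \<open>Here \<open>p\<close> is the mass removed and \<open>q\<close> the mass added at each
  point. Both vectors have total mass 1, so the two amounts agree, and together they make up the l1
  distance.\<close>

lemma transport_parts:
  fixes \<mu> \<nu> :: "'a \<Rightarrow> real"
  assumes "finite S" "\<mu> \<in> prob_vectors S" "\<nu> \<in> prob_vectors S"
  defines "p \<equiv> \<lambda>i. pos_part (\<mu> i - \<nu> i)" and "q \<equiv> \<lambda>i. pos_part (\<nu> i - \<mu> i)"
  shows "sum p S = l1_dist S \<nu> \<mu> / 2" "sum q S = l1_dist S \<nu> \<mu> / 2"
proof -
  have "sum p S - sum q S = (\<Sum>i\<in>S. \<mu> i - \<nu> i)"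
    unfolding sum_subtractf[symmetric] p_def q_def
    by (rule sum.cong) (auto simp: pos_part_def)
  also have "\<dots> = 0" using assms by (simp add: prob_vectors_def sum_subtractf)
  finally have 1: "sum p S = sum q S" by simp
  have "sum p S + sum q S = l1_dist S \<nu> \<mu>"
    unfolding sum.distrib[symmetric] p_def q_def l1_dist_def
    by (rule sum.cong) (auto simp: pos_part_def)
  with 1 show "sum p S = l1_dist S \<nu> \<mu> / 2" "sum q S = l1_dist S \<nu> \<mu> / 2" by auto
qed

text \<open>This identity isolates the duality gap. The last sum charges for mass added away from
  cost \<open>m\<close>, for mass left in place above \<open>c\<close>, and for mass removed below
  \<open>c\<close>. It is nonnegative once \<open>m\<close> is a lower bound of \<open>l\<close>,
  since 0 \<le> \<open>p\<close> \<le> \<mu> on \<open>S\<close>.\<close>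

lemma transport_gain:
  fixes \<mu> \<nu> l :: "'a \<Rightarrow> real"
  assumes S: "finite S" and \<mu>: "\<mu> \<in> prob_vectors S" and \<nu>: "\<nu> \<in> prob_vectors S"
  defines "p \<equiv> \<lambda>i. pos_part (\<mu> i - \<nu> i)" and "q \<equiv> \<lambda>i. pos_part (\<nu> i - \<mu> i)"
  shows "(\<Sum>i\<in>S. l i * \<mu> i) - (\<Sum>i\<in>S. l i * \<nu> i) =
    (\<Sum>i | i \<in> S \<and> l i > c. (l i - c) * \<mu> i) + (c - m) * (l1_dist S \<nu> \<mu> / 2)
    - (\<Sum>i\<in>S. (l i - m) * q i + (if l i > c then (l i - c) * (\<mu> i - p i) else (c - l i) * p i))"
    (is "?L = ?G + (c - m) * ?d - ?E")
proof -
  note d = transport_parts[OF S \<mu> \<nu>, folded p_def q_def]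
  have G: "?G = (\<Sum>i\<in>S. if l i > c then (l i - c) * \<mu> i else 0)"
    using S by (simp add: sum.inter_filter)
  have "?L = (\<Sum>i\<in>S. l i * (p i - q i))"
    unfolding sum_subtractf[symmetric] right_diff_distrib[symmetric] p_def q_def
    by (rule sum.cong) (auto simp: pos_part_def)
  \<comment> \<open>The terms are compared pointwise: \<open>l i - c\<close> times
    \<open>p i\<close> is kept as a loss below the threshold, and above it is rewritten as
    \<open>l i - c\<close> times \<open>\<mu> i\<close> minus the same factor times
    \<open>\<mu> i - p i\<close>.\<close>
  also have "\<dots> = ?G + c * sum p S - m * sum q S - ?E"
    unfolding G sum_distrib_left sum_subtractf[symmetric] sum.distrib[symmetric]
    by (rule sum.cong) (auto simp: algebra_simps)
  finally show ?thesis unfolding d by (simp add: left_diff_distrib)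
qed

text \<open>Dropping the nonnegative gap from \<open>transport_gain\<close> gives the bound. If the
  bound is attained, the gap is zero, hence each of its summands is, and these vanishing products
  are the complementary slackness conditions of the second claim.\<close>

lemma threshold_bound:
  fixes \<mu> \<nu> l :: "'a \<Rightarrow> real"
  assumes S: "finite S" and \<mu>: "\<mu> \<in> prob_vectors S" and \<nu>: "\<nu> \<in> feasible S l D"
    and m: "\<And>i. i \<in> S \<Longrightarrow> m \<le> l i" and mc: "m < c"
    and D: "(\<Sum>i\<in>S. l i * \<mu> i) - D = (\<Sum>i | i \<in> S \<and> l i > c. (l i - c) * \<mu> i) + (c - m) * \<delta>"
  shows "2 * \<delta> \<le> l1_dist S \<nu> \<mu>"
    and "l1_dist S \<nu> \<mu> = 2 * \<delta> \<Longrightarrow> i \<in> S \<Longrightarrow>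
      (m < l i \<longrightarrow> \<nu> i \<le> \<mu> i) \<and> (l i > c \<longrightarrow> \<nu> i = 0) \<and> (l i < c \<longrightarrow> \<nu> i \<ge> \<mu> i)"
proof -
  define p where "p = (\<lambda>i. pos_part (\<mu> i - \<nu> i))"
  define q where "q = (\<lambda>i. pos_part (\<nu> i - \<mu> i))"
  define e where "e = (\<lambda>i. (l i - m) * q i +
    (if l i > c then (l i - c) * (\<mu> i - p i) else (c - l i) * p i))"
  have \<nu>P: "\<nu> \<in> prob_vectors S" and \<nu>D: "(\<Sum>i\<in>S. l i * \<nu> i) \<le> D"
    using \<nu> by (auto simp: feasible_def)
  have q0: "q i \<ge> 0" and p0: "p i \<ge> 0" for i by (auto simp: p_def q_def pos_part_def)
  have pm: "p i \<le> \<mu> i" if "i \<in> S" for i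
    using that \<mu> \<nu>P by (auto simp: p_def pos_part_def prob_vectors_def)
  have e1: "(l i - m) * q i \<ge> 0" if "i \<in> S" for i using m[OF that] q0 by simp
  have e2: "(if l i > c then (l i - c) * (\<mu> i - p i) else (c - l i) * p i) \<ge> 0"
    if "i \<in> S" for i using pm[OF that] p0 by simp
  have e0: "e i \<ge> 0" if "i \<in> S" for i
    unfolding e_def using e1[OF that] e2[OF that] by (rule add_nonneg_nonneg)
  have gain: "(c - m) * \<delta> + sum e S \<le> (c - m) * (l1_dist S \<nu> \<mu> / 2)"
    using transport_gain[OF S \<mu> \<nu>P, of l c m] D \<nu>D unfolding e_def p_def q_def by linarith
  moreover have es: "sum e S \<ge> 0" by (rule sum_nonneg) (rule e0)
  ultimately have "(c - m) * \<delta> \<le> (c - m) * (l1_dist S \<nu> \<mu> / 2)" by linarith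
  then show "2 * \<delta> \<le> l1_dist S \<nu> \<mu>" using mc by simp
  assume "l1_dist S \<nu> \<mu> = 2 * \<delta>" and i: "i \<in> S"
  with gain es have "sum e S = 0" by simp
  then have "e i = 0" using sum_nonneg_eq_0_iff[OF S, of e] e0 i by blast
  with e1[OF i] e2[OF i] have
    z: "(l i - m) * q i = 0" "(if l i > c then (l i - c) * (\<mu> i - p i) else (c - l i) * p i) = 0"
    unfolding e_def by linarith+
  have "\<nu> i \<le> \<mu> i" if "m < l i" using z(1) that by (auto simp: q_def pos_part_def)
  moreover have "\<nu> i = 0" if "l i > c"
  proof -
    have "\<mu> i = p i" using z(2) that by simp
    \<comment> \<open>Full removal, \<open>p i = \<mu> i\<close>, would still allow mass to be added
      where \<open>\<mu> i = 0\<close>. The vanishing of \<open>q i\<close> above \<open>m\<close>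
      excludes that.\<close>
    then have "\<nu> i = 0 \<or> \<mu> i = 0 \<and> \<nu> i \<ge> 0"
      using \<nu>P i by (auto simp: p_def pos_part_def prob_vectors_def max_def split: if_splits)
    moreover have "\<nu> i \<le> \<mu> i" using z(1) that mc by (auto simp: q_def pos_part_def)
    ultimately show ?thesis by linarith
  qed
  moreover have "\<nu> i \<ge> \<mu> i" if "l i < c" using z(2) that by (auto simp: p_def pos_part_def)
  ultimately show "(m < l i \<longrightarrow> \<nu> i \<le> \<mu> i) \<and> (l i > c \<longrightarrow> \<nu> i = 0) \<and> (l i < c \<longrightarrow> \<nu> i \<ge> \<mu> i)"
    by blast
qed

text \<open>The two bounds on \<delta> say that the greedy removal exhausts everything above
  \<open>c\<close> and stops within the level \<open>c\<close>. So all mass above \<open>c\<close>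
  and a fixed fraction of the mass at \<open>c\<close> are moved to the single point
  \<open>b\<close>.\<close>

lemma threshold_attained:
  fixes \<mu> l :: "'a \<Rightarrow> real"
  assumes S: "finite S" and \<mu>: "\<mu> \<in> prob_vectors S"
    and b: "b \<in> S" "l b = m" and mc: "m < c"
    and D: "(\<Sum>i\<in>S. l i * \<mu> i) - D = (\<Sum>i | i \<in> S \<and> l i > c. (l i - c) * \<mu> i) + (c - m) * \<delta>"
    and \<delta>: "sum \<mu> {i \<in> S. l i > c} \<le> \<delta>"
      "\<delta> \<le> sum \<mu> {i \<in> S. l i > c} + sum \<mu> {i \<in> S. l i = c}"
  shows "\<exists>\<nu>\<in>feasible S l D. l1_dist S \<nu> \<mu> = 2 * \<delta>"
proof -
  let ?A = "sum \<mu> {i \<in> S. l i > c}" and ?M = "sum \<mu> {i \<in> S. l i = c}"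
  have \<mu>0: "\<mu> i \<ge> 0" if "i \<in> S" for i using \<mu> that by (simp add: prob_vectors_def)
  have A0: "?A \<ge> 0" by (rule sum_nonneg) (simp add: \<mu>0)
  \<comment> \<open>If \<open>?M = 0\<close> then \<open>\<delta> = ?A\<close>, and the junk value \<open>t = 0 / 0 = 0\<close> is the right one.\<close>
  define t where "t = (\<delta> - ?A) / ?M"
  have tM: "t * ?M = \<delta> - ?A" using \<delta> by (cases "?M = 0") (auto simp: t_def)
  have M0: "?M \<ge> 0" by (rule sum_nonneg) (simp add: \<mu>0)
  have t: "0 \<le> t" "t \<le> 1"
    using \<delta> M0 by (auto simp: t_def divide_le_eq_1)
  define f where "f = (\<lambda>i. if l i > c then \<mu> i else if l i = c then t * \<mu> i else 0)"
  have f: "0 \<le> f i" "f i \<le> \<mu> i" if "i \<in> S" for i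
    using t \<mu>0[OF that] by (auto simp: f_def mult_left_le_one_le)
  define g where "g = (\<lambda>i. if i = b then \<delta> else 0)"
  \<comment> \<open>Nothing is removed at \<open>b\<close>, where the mass arrives. Removal and
    addition therefore never cancel, and the l1 distance is the sum of both.\<close>
  have fb: "f b = 0" using b mc by (simp add: f_def)
  have sf: "sum f S = \<delta>"
  proof -
    have "sum f S = (\<Sum>i\<in>S. if l i > c then \<mu> i else 0) + t * (\<Sum>i\<in>S. if l i = c then \<mu> i else 0)"
      unfolding sum_distrib_left sum.distrib[symmetric]
      by (rule sum.cong) (auto simp: f_def)
    also have "\<dots> = ?A + t * ?M" using S by (simp add: sum.inter_filter)
    finally show ?thesis using tM by simp
  qed
  have sg: "sum g S = \<delta>" and slg: "(\<Sum>i\<in>S. l i * g i) = m * \<delta>"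
    using S b by (auto simp: g_def if_distrib cong: if_cong)
  have slf: "(\<Sum>i\<in>S. l i * f i) = (\<Sum>i | i \<in> S \<and> l i > c. (l i - c) * \<mu> i) + c * \<delta>"
  proof -
    have "(\<Sum>i\<in>S. l i * f i) = (\<Sum>i\<in>S. if l i > c then (l i - c) * \<mu> i else 0) + c * sum f S"
      unfolding sum_distrib_left sum.distrib[symmetric]
      by (rule sum.cong) (auto simp: f_def algebra_simps)
    then show ?thesis using S sf by (simp add: sum.inter_filter)
  qed
  define \<nu> where "\<nu> = (\<lambda>i. \<mu> i - f i + g i)"
  have \<delta>0: "\<delta> \<ge> 0" using A0 \<delta> by linarith
  have g0: "g i \<ge> 0" for i using \<delta>0 by (simp add: g_def)
  have "\<nu> i \<ge> 0" if "i \<in> S" for i using f[OF that] g0[of i] by (simp add: \<nu>_def)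
  moreover have "sum \<nu> S = 1"
    using \<mu> sf sg by (simp add: \<nu>_def sum.distrib sum_subtractf prob_vectors_def)
  moreover have "(\<Sum>i\<in>S. l i * \<nu> i) = (\<Sum>i\<in>S. l i * \<mu> i) - (\<Sum>i\<in>S. l i * f i) + (\<Sum>i\<in>S. l i * g i)"
    by (simp add: \<nu>_def algebra_simps sum.distrib sum_subtractf)
  then have "(\<Sum>i\<in>S. l i * \<nu> i) = D" using D slf slg by (simp add: algebra_simps)
  ultimately have "\<nu> \<in> feasible S l D" by (simp add: feasible_def prob_vectors_def)
  moreover have "l1_dist S \<nu> \<mu> = sum f S + sum g S"
    unfolding l1_dist_def sum.distrib[symmetric]
  proof (rule sum.cong)
    fix i assume "i \<in> S"
    then show "\<bar>\<nu> i - \<mu> i\<bar> = f i + g i"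
      using f(1)[of i] fb \<delta>0 by (cases "i = b") (auto simp: \<nu>_def g_def)
  qed simp
  then have "l1_dist S \<nu> \<mu> = 2 * \<delta>" using sf sg by simp
  ultimately show ?thesis by blast
qed

section \<open>The levels of a non-constant \<open>l\<close>\<close>

lemma remaining_antimono: "j \<le> k \<Longrightarrow> remaining S l k \<subseteq> remaining S l j"
  by (force simp: remaining_def)

context
  fixes S :: "'a set" and l :: "'a \<Rightarrow> real"
  assumes finS: "finite S" and neS: "S \<noteq> {}" and lt: "l_min S l < l_max S l"
begin

lemma l_min_le: "i \<in> S \<Longrightarrow> l_min S l \<le> l i"
  using finS by (simp add: l_min_def)

lemma bottom_nonempty: "bottom S l \<noteq> {}"
proof -
  have "Min (l ` S) \<in> l ` S" using finS neS by (intro Min_in) auto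
  then show ?thesis by (auto simp: bottom_def l_min_def)
qed

text \<open>The recursion treats the top level separately. As \<open>l\<close> is not constant, the
  top level lies outside the bottom, so index 0 follows the same pattern as the later indices and
  needs no special case below.\<close>

lemma level_value_0: "remaining S l 0 \<noteq> {}" "level_value S l 0 = l_max S l"
proof -
  have "Max (l ` S) \<in> l ` S" using finS neS by (intro Max_in) auto
  then obtain x where x: "x \<in> S" "l x = l_max S l" by (auto simp: l_max_def)
  then have xr: "x \<in> remaining S l 0" using lt by (simp add: remaining_def bottom_def)
  then show "remaining S l 0 \<noteq> {}" by auto
  show "level_value S l 0 = l_max S l" unfolding level_value_def
  proof (rule Max_eqI)
    show "finite (l ` remaining S l 0)" using finS by (simp add: remaining_def)
    show "y \<le> l_max S l" if "y \<in> l ` remaining S l 0" for y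
      using that finS by (auto simp: remaining_def l_max_def)
    show "l_max S l \<in> l ` remaining S l 0" using xr x by force
  qed
qed

lemma level_eq:
  "level S l k = (if remaining S l k = {} then {} else {i \<in> S. l i = level_value S l k})"
proof (cases k)
  case 0
  then show ?thesis using level_value_0 by simp
next
  case (Suc j)
  then show ?thesis
    by (simp add: Let_def level_value_def remaining_def lessThan_Suc_atMost del: Un_iff UN_iff)
qed

lemma level_value_attained:
  assumes "remaining S l k \<noteq> {}"
  shows "\<exists>x\<in>remaining S l k. l x = level_value S l k"
proof -
  have "Max (l ` remaining S l k) \<in> l ` remaining S l k"
    using finS assms by (intro Max_in) (auto simp: remaining_def)
  then show ?thesis by (auto simp: level_value_def)
qed

lemma l_min_less_level_value: "remaining S l k \<noteq> {} \<Longrightarrow> l_min S l < level_value S l k"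
  using level_value_attained[of k] l_min_le by (force simp: remaining_def bottom_def)

text \<open>A point whose cost exceeds the maximum over the remaining points is neither remaining
  nor in the bottom, so an earlier level took it. Conversely, a point that still remains at stage
  \<open>k\<close> costs strictly less than any earlier level value, as equality would have put it
  into that level.\<close>

lemma Union_levels:
  assumes ne: "remaining S l k \<noteq> {}"
  shows "(\<Union>j<k. level S l j) = {i \<in> S. level_value S l k < l i}"
proof (intro set_eqI iffI)
  fix i assume "i \<in> {i \<in> S. level_value S l k < l i}"
  then have i: "i \<in> S" "level_value S l k < l i" by auto
  have "i \<notin> remaining S l k"
  proof
    assume "i \<in> remaining S l k"
    then have "l i \<le> level_value S l k"
      using finS by (simp add: level_value_def remaining_def)
    with i show False by simp
  qed
  moreover have "i \<notin> bottom S l" using i l_min_less_level_value[OF ne] by (simp add: bottom_def)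
  ultimately show "i \<in> (\<Union>j<k. level S l j)" using i by (auto simp: remaining_def)
next
  fix i assume "i \<in> (\<Union>j<k. level S l j)"
  then obtain j where j: "j < k" "i \<in> level S l j" by auto
  then have ij: "i \<in> S" "l i = level_value S l j"
    using level_eq[of j] by (auto split: if_splits)
  obtain x where x: "x \<in> remaining S l k" "l x = level_value S l k"
    using level_value_attained[OF ne] by blast
  have xj: "x \<in> remaining S l j" using x(1) j(1) remaining_antimono[of j k S l] by auto
  then have "l x \<le> level_value S l j" using finS by (simp add: level_value_def remaining_def)
  moreover have "l x \<noteq> level_value S l j"
  proof
    assume "l x = level_value S l j"
    then have "x \<in> level S l j" using xj level_eq[of j] by (auto simp: remaining_def)
    then show False using x(1) j(1) by (auto simp: remaining_def)
  qed
  ultimately show "i \<in> {i \<in> S. level_value S l k < l i}" using ij x by simp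
qed

lemma level_value_strict_antimono:
  assumes "j < k" "remaining S l k \<noteq> {}"
  shows "level_value S l k < level_value S l j"
proof -
  have ne: "remaining S l j \<noteq> {}" using assms remaining_antimono[of j k S l] by auto
  obtain x where "x \<in> remaining S l j" "l x = level_value S l j"
    using level_value_attained[OF ne] by blast
  then have "x \<in> level S l j" "l x = level_value S l j"
    using ne level_eq[of j] by (auto simp: remaining_def)
  then have "x \<in> (\<Union>j<k. level S l j)" "l x = level_value S l j" using assms by auto
  then show ?thesis unfolding Union_levels[OF assms(2)] by simp
qed

text \<open>The number of levels is defined as a cardinality. It bounds the indices because the
  index set \<open>K\<close> is finite, its level values being distinct values of \<open>l\<close>,
  and closed downwards to 1, the sets \<open>remaining S l k\<close> being decreasing.\<close>

lemma remaining_nonempty_iff: "remaining S l k \<noteq> {} \<longleftrightarrow> k \<le> num_levels S l"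
proof -
  define K where "K = {k. 1 \<le> k \<and> remaining S l k \<noteq> {}}"
  have "inj_on (level_value S l) K"
    by (rule linorder_inj_onI) (auto simp: K_def dest: level_value_strict_antimono)
  moreover have "level_value S l ` K \<subseteq> l ` S"
  proof
    fix y assume "y \<in> level_value S l ` K"
    then obtain k where k: "remaining S l k \<noteq> {}" "y = level_value S l k" by (auto simp: K_def)
    obtain x where x: "x \<in> remaining S l k" "l x = level_value S l k"
      using level_value_attained[OF k(1)] by blast
    then have "x \<in> S" by (simp add: remaining_def)
    then show "y \<in> l ` S" unfolding k(2) x(2)[symmetric] by (rule imageI)
  qed
  ultimately have fin: "finite K"
    using finS by (meson finite_imageI inj_on_finite)
  have down: "j \<in> K" if "k \<in> K" "1 \<le> j" "j \<le> k" for j k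
    using that remaining_antimono[of j k S l] by (auto simp: K_def)
  have "K = {1..card K}"
  proof (cases "K = {}")
    case False
    have "k \<ge> 1" if "k \<in> K" for k using that by (simp add: K_def)
    then have "K \<subseteq> {1..Max K}" using Max_ge[OF fin] by auto
    moreover have "{1..Max K} \<subseteq> K" using down[OF Max_in[OF fin False]] by auto
    ultimately have "K = {1..Max K}" by blast
    then have "card K = Max K" by (metis card_atLeastAtMost diff_Suc_1)
    with \<open>K = {1..Max K}\<close> show ?thesis by simp
  qed simp
  moreover have "card K = num_levels S l" by (simp add: K_def num_levels_def)
  ultimately have "k \<in> K \<longleftrightarrow> 1 \<le> k \<and> k \<le> num_levels S l" by auto
  \<comment> \<open>\<open>K\<close> contains positive indices only, so index 0 is supplied by
    \<open>level_value_0\<close>.\<close>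
  then have "1 \<le> k \<Longrightarrow> ?thesis" by (simp add: K_def)
  then show ?thesis using level_value_0(1) by (cases "k = 0") auto
qed

lemma level_fibre:
  "k \<le> num_levels S l \<Longrightarrow> level S l k = {i \<in> S. l i = level_value S l k}"
  using level_eq[of k] remaining_nonempty_iff[of k] by simp

lemma levels_disjoint:
  assumes "i \<le> num_levels S l" "j \<le> num_levels S l" "i \<noteq> j"
  shows "level S l i \<inter> level S l j = {}"
proof -
  have "level_value S l i \<noteq> level_value S l j"
    using assms level_value_strict_antimono[of i j] level_value_strict_antimono[of j i]
    unfolding remaining_nonempty_iff by linarith
  then show ?thesis unfolding level_fibre[OF assms(1)] level_fibre[OF assms(2)] by auto
qed

lemma sum_Union_levels:
  fixes h :: "'a \<Rightarrow> real"
  assumes "finite I" "\<And>j. j \<in> I \<Longrightarrow> j \<le> num_levels S l"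
  shows "(\<Sum>j\<in>I. sum h (level S l j)) = sum h (\<Union>j\<in>I. level S l j)"
proof (rule sum.UNION_disjoint[symmetric])
  show "\<forall>j\<in>I. finite (level S l j)" using assms finS by (simp add: level_fibre)
  show "\<forall>i\<in>I. \<forall>j\<in>I. i \<noteq> j \<longrightarrow> level S l i \<inter> level S l j = {}"
    using assms(2) levels_disjoint by blast
qed (rule assms(1))

text \<open>This turns the sums over level indices of the theorem into the threshold sums of the
  duality argument.\<close>

lemma sum_levels_above:
  fixes h :: "'a \<Rightarrow> real"
  assumes "k \<le> num_levels S l"
  shows "(\<Sum>j<k. sum h (level S l j)) = sum h {i \<in> S. level_value S l k < l i}"
  using sum_Union_levels[of "{..<k}" h] Union_levels[of k] assms
  unfolding remaining_nonempty_iff by simp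

text \<open>The bottom and the levels up to the last index partition \<open>S\<close>: level values
  exceed the minimum, and nothing remains at the next stage.\<close>

lemma sum_all_levels:
  fixes h :: "'a \<Rightarrow> real"
  shows "sum h (bottom S l) + (\<Sum>j\<le>num_levels S l. sum h (level S l j)) = sum h S"
proof -
  let ?U = "\<Union>j\<le>num_levels S l. level S l j"
  have "(\<Sum>j\<le>num_levels S l. sum h (level S l j)) = sum h ?U"
    by (rule sum_Union_levels) simp_all
  moreover have "bottom S l \<inter> ?U = {}"
  proof -
    have "l i \<noteq> l_min S l" if "j \<le> num_levels S l" "i \<in> level S l j" for i j
      using that l_min_less_level_value[of j] remaining_nonempty_iff[of j] by (simp add: level_fibre)
    then show ?thesis by (auto simp: bottom_def)
  qed
  moreover have "bottom S l \<union> ?U = S"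
  proof -
    have "remaining S l (Suc (num_levels S l)) = {}"
      using remaining_nonempty_iff[of "Suc (num_levels S l)"] by simp
    then have "S \<subseteq> bottom S l \<union> ?U" by (auto simp: remaining_def lessThan_Suc_atMost)
    then show ?thesis by (auto simp: bottom_def level_fibre)
  qed
  moreover have "finite (bottom S l)" "finite ?U" using finS by (auto simp: bottom_def level_fibre)
  ultimately show ?thesis by (metis sum.union_disjoint)
qed

section \<open>Value and optimal masses when the removal stops in level \<open>k\<close>\<close>

text \<open>Allowing \<open>k = 0\<close> treats both cases of the main theorem at once. The
  equation for \<open>D\<close> says that moving mass \<delta> greedily lowers the mean cost exactly
  to \<open>D\<close>, and the bounds on \<delta> say that the removal stops in level
  \<open>k\<close>.\<close>

theorem R_minus_at_level:
  fixes \<mu> :: "'a \<Rightarrow> real" and D \<delta> :: real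
  assumes \<mu>: "\<mu> \<in> prob_vectors S" and k: "k \<le> num_levels S l"
  defines "A \<equiv> \<lambda>k. \<Sum>j<k. sum \<mu> (level S l j)" and "c \<equiv> level_value S l k"
  assumes D: "(\<Sum>i\<in>S. l i * \<mu> i) - D =
      (\<Sum>j<k. \<Sum>i\<in>level S l j. (l i - c) * \<mu> i) + (c - l_min S l) * \<delta>"
    and \<delta>: "A k \<le> \<delta>" "\<delta> \<le> A (Suc k)"
  shows "R_minus S \<mu> l D = 2 * \<delta>" "minimizers S \<mu> l D \<noteq> {}"
    "\<nu> \<in> minimizers S \<mu> l D \<Longrightarrow> has_optimal_masses S \<mu> l D \<nu>"
proof -
  let ?r = "num_levels S l" and ?m = "l_min S l"
  have \<mu>0: "\<mu> i \<ge> 0" if "i \<in> S" for i using \<mu> that by (simp add: prob_vectors_def)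
  have lev0: "sum \<mu> (level S l j) \<ge> 0" for j
    by (rule sum_nonneg) (auto simp: level_eq \<mu>0 split: if_splits)
  have Amono: "A i \<le> A j" if "i \<le> j" for i j
    unfolding A_def using that lev0 by (intro sum_mono2) auto
  have A0: "A 0 = 0" by (simp add: A_def)
  have Asuc: "A (Suc j) = A j + sum \<mu> (level S l j)" for j by (simp add: A_def)
  have \<delta>0: "\<delta> \<ge> 0" using \<delta> Amono[of 0 k] A0 by simp
  have mc: "?m < c" using l_min_less_level_value[of k] remaining_nonempty_iff[of k] k by (simp add: c_def)
  have Ak: "A k = sum \<mu> {i \<in> S. l i > c}" using sum_levels_above[OF k] by (simp add: A_def c_def)
  have Ek: "level S l k = {i \<in> S. l i = c}" using level_fibre[OF k] by (simp add: c_def)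
  have D': "(\<Sum>i\<in>S. l i * \<mu> i) - D = (\<Sum>i | i \<in> S \<and> l i > c. (l i - c) * \<mu> i) + (c - ?m) * \<delta>"
    using D sum_levels_above[OF k] by (simp add: c_def)
  obtain b where b: "b \<in> S" "l b = ?m" using bottom_nonempty by (auto simp: bottom_def)
  note bound = threshold_bound[OF finS \<mu> _ _ mc D', OF _ l_min_le]
  obtain \<nu>0 where \<nu>0: "\<nu>0 \<in> feasible S l D" "l1_dist S \<nu>0 \<mu> = 2 * \<delta>"
    using threshold_attained[OF finS \<mu> b mc D'] \<delta> Asuc[of k] Ak Ek by auto
  show R: "R_minus S \<mu> l D = 2 * \<delta>" unfolding R_minus_def
  proof (rule cInf_eq_minimum)
    show "2 * \<delta> \<in> (\<lambda>\<nu>. l1_dist S \<nu> \<mu>) ` feasible S l D" using \<nu>0 by force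
  qed (use bound(1) in auto)
  then show "minimizers S \<mu> l D \<noteq> {}" using \<nu>0 by (auto simp: minimizers_def)
  \<comment> \<open>No more can be moved than lies outside the bottom, so the minimum in
    \<open>alpha\<close> is its first argument.\<close>
  have "\<delta> \<le> A (Suc ?r)" using \<delta> Amono[of "Suc k" "Suc ?r"] k by simp
  also have "\<dots> = 1 - sum \<mu> (bottom S l)"
    using sum_all_levels[of \<mu>] \<mu> by (simp add: A_def prob_vectors_def lessThan_Suc_atMost)
  finally have \<alpha>: "alpha S \<mu> l D = \<delta>" by (simp add: alpha_def R)
  assume "\<nu> \<in> minimizers S \<mu> l D"
  then have \<nu>: "\<nu> \<in> feasible S l D" "l1_dist S \<nu> \<mu> = 2 * \<delta>" using R by (auto simp: minimizers_def)
  have \<nu>P: "\<nu> \<in> prob_vectors S" using \<nu> by (simp add: feasible_def)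
  have opt: "(?m < l i \<longrightarrow> \<nu> i \<le> \<mu> i) \<and> (l i > c \<longrightarrow> \<nu> i = 0) \<and> (l i < c \<longrightarrow> \<nu> i \<ge> \<mu> i)"
    if "i \<in> S" for i
    by (rule bound(2)[OF \<nu>(1) _ \<nu>(2) that])
  have below: "sum \<nu> (level S l j) = sum \<mu> (level S l j)" if "k < j" "j \<le> ?r" for j
  proof (rule sum.cong)
    fix i assume "i \<in> level S l j"
    then have i: "i \<in> S" "l i = level_value S l j" using that by (auto simp: level_fibre)
    have "remaining S l j \<noteq> {}" using that remaining_nonempty_iff[of j] by simp
    then have "l i < c" "?m < l i"
      using i that level_value_strict_antimono[of k j] l_min_less_level_value[of j]
      by (simp_all add: c_def)
    then show "\<nu> i = \<mu> i" using opt[OF i(1)] by simp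
  qed simp
  have above: "sum \<nu> (level S l j) = 0" if "j < k" for j
  proof (rule sum.neutral, rule ballI)
    fix i assume "i \<in> level S l j"
    then have i: "i \<in> S" "l i = level_value S l j" using that k by (auto simp: level_fibre)
    then have "l i > c"
      using k that level_value_strict_antimono[of j k] remaining_nonempty_iff[of k]
      by (simp add: c_def)
    then show "\<nu> i = 0" using opt[OF i(1)] by simp
  qed
  have bot: "sum \<nu> (bottom S l) = sum \<mu> (bottom S l) + \<delta>"
  proof -
    \<comment> \<open>By the slackness conditions mass is added only in the bottom, and there no
      mass is removed. Hence the bottom gains the whole of \<delta>.\<close>
    have q: "pos_part (\<nu> i - \<mu> i) = (if i \<in> bottom S l then \<nu> i - \<mu> i else 0)" if "i \<in> S" for i
      using opt[OF that] l_min_le[OF that] that mc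
      by (auto simp: pos_part_def bottom_def max_def)
    have "\<delta> = (\<Sum>i\<in>S. pos_part (\<nu> i - \<mu> i))"
      using transport_parts(2)[OF finS \<mu> \<nu>P] \<nu>(2) by simp
    also have "\<dots> = (\<Sum>i\<in>S. if i \<in> bottom S l then \<nu> i - \<mu> i else 0)"
      by (rule sum.cong) (simp_all add: q)
    also have "\<dots> = (\<Sum>i\<in>S \<inter> bottom S l. \<nu> i - \<mu> i)"
      by (rule sum.inter_restrict[symmetric]) (rule finS)
    also have "S \<inter> bottom S l = bottom S l" by (auto simp: bottom_def)
    finally show ?thesis by (simp add: sum_subtractf)
  qed
  \<comment> \<open>At the threshold level slackness gives only \<nu> \<le> \<mu> and does not fix
    the mass. It follows from conservation of total mass, all other levels and the bottom being
    known.\<close>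
  have at: "sum \<nu> (level S l k) = A (Suc k) - \<delta>"
  proof -
    have split: "(\<Sum>j\<le>?r. h j) = (\<Sum>j<k. h j) + h k + (\<Sum>j\<in>{k<..?r}. h j)" for h :: "nat \<Rightarrow> real"
    proof -
      have "{..?r} = insert k {..<k} \<union> {k<..?r}" using k by auto
      moreover have "insert k {..<k} \<inter> {k<..?r} = {}" by auto
      ultimately have "sum h {..?r} = sum h (insert k {..<k}) + sum h {k<..?r}"
        by (simp only:) (rule sum.union_disjoint, simp_all)
      then show ?thesis by simp
    qed
    have "sum \<nu> S = sum \<mu> S" using \<mu> \<nu>P by (simp add: prob_vectors_def)
    moreover have "(\<Sum>j\<in>{k<..?r}. sum \<nu> (level S l j)) = (\<Sum>j\<in>{k<..?r}. sum \<mu> (level S l j))"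
      by (rule sum.cong) (simp_all add: below)
    moreover have "(\<Sum>j<k. sum \<nu> (level S l j)) = 0" by (simp add: above)
    ultimately show ?thesis
      using sum_all_levels[of \<mu>] sum_all_levels[of \<nu>] bot Asuc[of k] unfolding split
      by (simp add: A_def)
  qed
  \<comment> \<open>The nested positive parts encode the three situations: levels before
    \<open>k\<close> are emptied as \<delta> \<ge> \<open>A (Suc j)\<close>, level \<open>k\<close>
    is partly emptied, and later levels are untouched as \<delta> \<le> \<open>A j\<close>.\<close>
  have mass: "sum \<nu> (level S l j) = pos_part (sum \<mu> (level S l j) - pos_part (\<delta> - A j))"
    if "j \<le> ?r" for j
  proof (cases j k rule: linorder_cases)
    case less
    then have "A (Suc j) \<le> \<delta>" using Amono[of "Suc j" k] \<delta> by simp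
    then show ?thesis using above[OF less] Asuc[of j] lev0[of j] by (simp add: pos_part_def)
  next
    case equal
    then show ?thesis using at \<delta> Asuc[of k] by (simp add: pos_part_def)
  next
    case greater
    then have "\<delta> \<le> A j" using Amono[of "Suc k" j] \<delta> by simp
    then show ?thesis using below[OF greater that] lev0[of j] by (simp add: pos_part_def)
  qed
  have "(\<Sum>i=1..j. sum \<mu> (level S l (i - 1))) = A j" for j
    unfolding A_def by (induction j) auto
  then show "has_optimal_masses S \<mu> l D \<nu>"
    unfolding has_optimal_masses_def \<alpha> using bot mass mass[of 0] \<delta>0 A0
    by (simp add: pos_part_def)
qed

end

section \<open>Translation of the two cases into bounds on the moved mass\<close>

theorem mainTheorem2:
  fixes S :: "'a set" and \<mu> l :: "'a \<Rightarrow> real" and D :: real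
  assumes "finite S" and "S \<noteq> {}"
    and "\<mu> \<in> prob_vectors S"
    and "\<forall>i\<in>S. 0 \<le> l i"
    and "0 \<le> D" and "D < (\<Sum>i\<in>S. l i * \<mu> i)"
  defines "r \<equiv> num_levels S l"
    and "case1 \<equiv> (\<lambda>k.
      l_min S l * ((\<Sum>j=0..k. sum \<mu> (level S l j)) + sum \<mu> (bottom S l))
        + (\<Sum>j=k+1..num_levels S l. \<Sum>i\<in>level S l j. l i * \<mu> i) \<le> D \<and>
      D \<le> l_min S l * ((\<Sum>j=1..k. sum \<mu> (level S l (j - 1))) + sum \<mu> (bottom S l))
        + (\<Sum>j=k..num_levels S l. \<Sum>i\<in>level S l j. l i * \<mu> i))"
    and "case2 \<equiv>
      (l_min S l - l_max S l) * sum \<mu> (level S l 0) + (\<Sum>i\<in>S. l i * \<mu> i) \<le> D"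
  shows "(\<forall>k\<in>{1..r}. case1 k \<longrightarrow>
            R_minus S \<mu> l D =
              2 * (D - l_min S l * sum \<mu> (bottom S l)
                     - level_value S l k * (\<Sum>j=1..k. sum \<mu> (level S l (j - 1)))
                     - (\<Sum>j=k..r. \<Sum>i\<in>level S l j. l i * \<mu> i))
                / (l_min S l - level_value S l k))
       \<and> (case2 \<longrightarrow>
            R_minus S \<mu> l D = 2 * (D - (\<Sum>i\<in>S. l i * \<mu> i)) / (l_min S l - l_max S l))
       \<and> ((\<exists>k\<in>{1..r}. case1 k) \<or> case2 \<longrightarrow>
            minimizers S \<mu> l D \<noteq> {} \<and>
            (\<forall>\<nu>\<in>minimizers S \<mu> l D. has_optimal_masses S \<mu> l D \<nu>))"
proof (cases "l_min S l < l_max S l")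
  case lt: True
  note level = R_minus_at_level[OF assms(1,2) lt assms(3)]
  define A where "A = (\<lambda>k. \<Sum>j<k. sum \<mu> (level S l j))"
  define T where "T = (\<lambda>k. \<Sum>j=k..r. \<Sum>i\<in>level S l j. l i * \<mu> i)"
  \<comment> \<open>This solves the cost equation of \<open>R_minus_at_level\<close> for the moved
    mass, and is half of the claimed value in case (1).\<close>
  define \<delta> where "\<delta> = (\<lambda>k. (D - l_min S l * sum \<mu> (bottom S l) - level_value S l k * A k - T k)
    / (l_min S l - level_value S l k))"
  have A_shift: "(\<Sum>j=1..k. sum \<mu> (level S l (j - 1))) = A k" for k
    unfolding A_def by (induction k) auto
  have A_Suc: "A (Suc k) = A k + sum \<mu> (level S l k)" for k by (simp add: A_def)
  have A_0: "(\<Sum>j=0..k. sum \<mu> (level S l j)) = A (Suc k)" for k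
    by (simp add: A_def atLeast0AtMost lessThan_Suc_atMost)
  have split: "(\<Sum>i\<in>S. l i * \<mu> i) = l_min S l * sum \<mu> (bottom S l)
      + (\<Sum>j<k. \<Sum>i\<in>level S l j. l i * \<mu> i) + T k" if "k \<le> r" for k
  proof -
    have "{..r} = {..<k} \<union> {k..r}" using that by auto
    then have "(\<Sum>j\<le>r. \<Sum>i\<in>level S l j. l i * \<mu> i) =
        (\<Sum>j<k. \<Sum>i\<in>level S l j. l i * \<mu> i) + T k"
      unfolding T_def by (simp add: sum.union_disjoint ivl_disj_int_one)
    moreover have "(\<Sum>i\<in>bottom S l. l i * \<mu> i) = l_min S l * sum \<mu> (bottom S l)"
      by (simp add: sum_distrib_left bottom_def)
    ultimately show ?thesis
      using sum_all_levels[OF assms(1,2) lt, of "\<lambda>i. l i * \<mu> i"] unfolding r_def by simp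
  qed
  \<comment> \<open>Multiplied by the positive difference of level value and minimum, the two bounds
    on \<open>D\<close> become \<open>A k\<close> \<le> \<delta> \<le> \<open>A (Suc k)\<close>. The
    upper bound on \<open>D\<close> yields the lower bound on \<delta>, and vice versa.\<close>
  have main: "R_minus S \<mu> l D = 2 * \<delta> k \<and> minimizers S \<mu> l D \<noteq> {} \<and>
      (\<forall>\<nu>\<in>minimizers S \<mu> l D. has_optimal_masses S \<mu> l D \<nu>)"
    if k: "k \<le> r"
      and lo: "l_min S l * (A (Suc k) + sum \<mu> (bottom S l)) + T (Suc k) \<le> D"
      and hi: "D \<le> l_min S l * (A k + sum \<mu> (bottom S l)) + T k" for k
  proof -
    let ?c = "level_value S l k"
    have mc: "l_min S l < ?c"
      using l_min_less_level_value[OF assms(1,2) lt, of k]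
        remaining_nonempty_iff[OF assms(1,2) lt, of k] k
      by (simp add: r_def)
    then have \<delta>: "(?c - l_min S l) * \<delta> k = l_min S l * sum \<mu> (bottom S l) + ?c * A k + T k - D"
      by (simp add: \<delta>_def field_simps)
    have "(\<Sum>i\<in>level S l k. l i * \<mu> i) = ?c * sum \<mu> (level S l k)"
      using level_fibre[OF assms(1,2) lt, of k] k by (simp add: sum_distrib_left r_def)
    then have T_Suc: "T k = ?c * sum \<mu> (level S l k) + T (Suc k)"
      unfolding T_def using k by (simp add: sum.atLeast_Suc_atMost)
    have "(?c - l_min S l) * A k \<le> (?c - l_min S l) * \<delta> k"
      using hi unfolding \<delta> by (simp add: algebra_simps)
    then have 1: "A k \<le> \<delta> k" using mc by simp
    have "(?c - l_min S l) * \<delta> k \<le> (?c - l_min S l) * A (Suc k)"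
      using lo unfolding \<delta> T_Suc A_Suc by (simp add: algebra_simps)
    then have 2: "\<delta> k \<le> A (Suc k)" using mc by simp
    have "(\<Sum>i\<in>S. l i * \<mu> i) - D =
      (\<Sum>j<k. \<Sum>i\<in>level S l j. (l i - ?c) * \<mu> i) + (?c - l_min S l) * \<delta> k"
      unfolding \<delta> split[OF k] A_def
      by (simp add: left_diff_distrib sum_subtractf sum_distrib_left)
    from level[OF k[unfolded r_def] this 1[unfolded A_def] 2[unfolded A_def]]
    show ?thesis by blast
  qed
  have c1: "R_minus S \<mu> l D = 2 * \<delta> k \<and> minimizers S \<mu> l D \<noteq> {} \<and>
      (\<forall>\<nu>\<in>minimizers S \<mu> l D. has_optimal_masses S \<mu> l D \<nu>)" if "k \<in> {1..r}" "case1 k" for k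
    using main[of k] that
    unfolding case1_def A_0 A_shift T_def r_def by simp
  have c2: "R_minus S \<mu> l D = 2 * \<delta> 0 \<and> minimizers S \<mu> l D \<noteq> {} \<and>
      (\<forall>\<nu>\<in>minimizers S \<mu> l D. has_optimal_masses S \<mu> l D \<nu>)" if case2
  \<comment> \<open>Case (2) is the instance \<open>k = 0\<close>: its hypothesis is the lower bound
    on \<open>D\<close>, and the upper bound is the assumption that \<open>D\<close> lies below the
    mean cost of \<mu>.\<close>
  proof (rule main)
    have "(\<Sum>i\<in>level S l 0. l i * \<mu> i) = l_max S l * sum \<mu> (level S l 0)"
      by (simp add: sum_distrib_left)
    then have "T 0 = l_max S l * sum \<mu> (level S l 0) + T (Suc 0)"
      unfolding T_def by (simp add: sum.atLeast_Suc_atMost)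
    then show "l_min S l * (A (Suc 0) + sum \<mu> (bottom S l)) + T (Suc 0) \<le> D"
      using that split[of 0] unfolding case2_def by (simp add: A_def algebra_simps)
    show "D \<le> l_min S l * (A 0 + sum \<mu> (bottom S l)) + T 0"
      using split[of 0] assms(6) by (simp add: A_def)
  qed simp
  have "\<delta> 0 = (D - (\<Sum>i\<in>S. l i * \<mu> i)) / (l_min S l - l_max S l)"
    unfolding \<delta>_def level_value_0(2)[OF assms(1,2) lt] split[of 0, simplified] by (simp add: A_def)
  then have \<delta>_0: "2 * \<delta> 0 = 2 * (D - (\<Sum>i\<in>S. l i * \<mu> i)) / (l_min S l - l_max S l)" by simp
  have \<delta>_k: "2 * \<delta> k = 2 * (D - l_min S l * sum \<mu> (bottom S l) - level_value S l k * A k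
      - (\<Sum>j=k..r. \<Sum>i\<in>level S l j. l i * \<mu> i)) / (l_min S l - level_value S l k)" for k
    by (simp add: \<delta>_def T_def)
  show ?thesis
    unfolding A_shift \<delta>_k[symmetric] \<delta>_0[symmetric]
    using c1 c2 by blast
next
  case False
  \<comment> \<open>Here \<open>l\<close> is constant and nothing is feasible, but neither case occurs.\<close>
  have const: "l i = l_min S l" "l i = l_max S l" if "i \<in> S" for i
  proof -
    have "l_min S l \<le> l i" "l i \<le> l_max S l"
      using assms(1) that by (auto simp: l_min_def l_max_def)
    with False show "l i = l_min S l" "l i = l_max S l" by auto
  qed
  obtain i where "i \<in> S" using assms(2) by blast
  then have "l_min S l = l_max S l" using const[of i] by simp
  then have "\<not> case2" using assms(6) by (simp add: case2_def)
  moreover have "bottom S l = S" using const(1) unfolding bottom_def by blast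
  then have "r = 0" by (simp add: r_def num_levels_def remaining_def)
  ultimately show ?thesis by simp
qed

end
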